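(* Let $(p_n)_n$ be a sequence in $(0,1)$ and define $$\alpha_1 = \limsup_n \frac{\log(1/p_n)}{\log n},\qquad \alpha_2 = \limsup_n \frac{\log\left(1/(1-p_n)\right)}{\log n}.$$ (1) If $\alpha_1>2$, fix $\epsilon>0$ small so that $\alpha_1-\epsilon>2$. Then $$\mathbb{P}\left(\omega(G(n,p_n))=1\right)\ge 1-\frac{1}{n^{\alpha_1-\epsilon-2}}$$ for all $n$ large. (2) If $\alpha_2>2$, fix $\epsilon>0$ small so that $\alpha_2-\epsilon>2$. Then $$\mathbb{P}\left(\omega(G(n,p_n))=n\right)\ge 1-\frac{1}{n^{\alpha_2-\epsilon-2}}$$ for all $n$ large. (3) If $1<\alpha_2<2$, fix $\epsilon>0$ small so that $0<2-\alpha_2-2\epsilon<2-\alpha_2+2\epsilon<1$. Then $$\mathbb{P}\left(\omega(G(n,p_n))\ge n-n^{2-\alpha_2+2\epsilon}\right)\ge 1-\exp\left(-n^{2-\alpha_2-2\epsilon}\right)$$ for all $n$ large. (4) Let $f_n\to\infty$ be any sequence and let $$U_n=\frac{2\log n+2f_n}{\log(1/p_n)}+1\ \ge 1.$$ Then $$\mathbb{P}\left(\omega(G(n,p_n))\le U_n\right)\ge 1-\exp\left(-f_nU_n\right)$$ for all $n\ge 2$.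
   Context: $G(n,p_n)$ is the homogeneous Erdős–Rényi random graph on vertex set $\{1,\dots,n\}$: each of the $\binom n2$ edges is present independently with probability $p_n$. $\omega(G)$ denotes the number of vertices in a largest clique (complete induced subgraph) of $G$.
   Formalization: In (1)–(3) α_1 and α_2 are defined with liminf instead of limsup (with limsup the claims fail, e.g. p_n=n^{-3} for even n, 1/2 for odd n) and taken finite; in (4) U_n ≥ 1 is a hypothesis at the n considered, since it can fail when f_n is very negative. *)

theory Defs
  imports "HOL-Probability.Probability" "HOL-Library.Ramsey"
begin

definition erdos_renyi :: "nat \<Rightarrow> real \<Rightarrow> nat set set pmf" where
  "erdos_renyi n p =
     map_pmf (\<lambda>present. {e \<in> nsets {1..n} 2. present e})
       (Pi_pmf (nsets {1..n} 2) False (\<lambda>_. bernoulli_pmf p))"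

definition clique_number :: "'a set \<Rightarrow> 'a set set \<Rightarrow> nat" where
  "clique_number V E = Max {card W |W. W \<subseteq> V \<and> clique W E}"

(* The lower limit is needed for rates valid for all large n: if q n is n powr (-3) for
   even n and 1/2 for odd n, the upper limit is 3, but q has no decay along odd n. *)
definition decay_exponent :: "(nat \<Rightarrow> real) \<Rightarrow> ereal" where
  "decay_exponent q = liminf (\<lambda>n. ereal (ln (1 / q n) / ln (real n)))"

definition prob_clique_number :: "nat \<Rightarrow> real \<Rightarrow> (nat \<Rightarrow> bool) \<Rightarrow> real" where
  "prob_clique_number n p P =
     measure_pmf.prob (erdos_renyi n p) {E. P (clique_number {1..n} E)}"

end

theory Submission
  imports Defs
begin

text \<open>
  Parts 1, 2 and 4 are first-moment bounds: a clique number different from 1 (from \<open>n\<close>) forces a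
  present (missing) edge, and a clique number at least \<open>k\<close> forces one of at most \<open>n ^ k\<close> vertex sets
  of size \<open>k\<close> to be complete, which has probability \<open>p ^ (k choose 2)\<close>.
  For part 3, deleting one endpoint of each missing edge leaves a clique, so the clique number is at
  least \<open>n\<close> minus the number of missing edges, whose upper tail is controlled by the exponential
  Markov inequality.
\<close>

section \<open>The clique number\<close>

lemma finite_clique_cards:
  assumes "finite V"
  shows "finite {card W |W. W \<subseteq> V \<and> clique W E}"
proof (rule finite_subset)
  show "{card W |W. W \<subseteq> V \<and> clique W E} \<subseteq> card ` Pow V"
    by auto
qed (use assms in simp)

lemma clique_number_ge:
  assumes "finite V" "W \<subseteq> V" "clique W E"
  shows "card W \<le> clique_number V E"
  unfolding clique_number_def
  using assms by (intro Max_ge finite_clique_cards) auto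

lemma clique_number_attained:
  assumes "finite V"
  obtains W where "W \<subseteq> V" "clique W E" "card W = clique_number V E"
proof -
  have "clique {} E"
    by (simp add: clique_def)
  then have "{card W |W. W \<subseteq> V \<and> clique W E} \<noteq> {}"
    by blast
  from Max_in[OF finite_clique_cards[OF assms] this] show ?thesis
    using that by (auto simp: clique_number_def)
qed

lemma clique_number_le_card:
  assumes "finite V"
  shows "clique_number V E \<le> card V"
  using clique_number_attained[OF assms, of E] card_mono[OF assms] by metis

lemma clique_iff_nsets_subset: "clique W E \<longleftrightarrow> nsets W 2 \<subseteq> E"
  by (auto simp: clique_def nsets_2_eq)

text \<open>With no edge inside \<open>V\<close>, a clique has no two-element subset and so at most
  one vertex. A singleton is always a clique, which is where \<open>V\<close> being nonempty
  enters.\<close>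

lemma clique_number_eq_1:
  assumes "finite V" "V \<noteq> {}" "nsets V 2 \<inter> E = {}"
  shows "clique_number V E = 1"
proof (rule antisym)
  obtain W where W: "W \<subseteq> V" "clique W E" "card W = clique_number V E"
    using clique_number_attained[OF assms(1)] by blast
  have "nsets W 2 = {}"
    using W assms(3) nsets_mono[of W V 2] unfolding clique_iff_nsets_subset by blast
  then show "clique_number V E \<le> 1"
    using W(3) by (simp add: nsets_eq_empty_iff)
  obtain v where "v \<in> V"
    using assms(2) by blast
  then show "1 \<le> clique_number V E"
    using clique_number_ge[OF assms(1), of "{v}" E] by (simp add: clique_def)
qed

text \<open>\<open>h\<close> selects one endpoint of each missing edge, so its image is a vertex
  cover of the missing edges. Endpoints may coincide, so removing the image costs at most as many
  vertices as there are missing edges.\<close>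

lemma card_le_clique_number_plus_missing:
  assumes "finite V"
  shows "card V \<le> clique_number V E + card (nsets V 2 - E)"
proof -
  define M where "M = nsets V 2 - E"
  define h where "h e = (SOME v. v \<in> e)" for e :: "'a set"
  have h: "h e \<in> e" if "e \<in> M" for e
    using that by (auto simp: h_def M_def some_in_eq nsets_2_eq)
  have finM: "finite M"
    using assms by (simp add: M_def finite_imp_finite_nsets)
  have "clique (V - h ` M) E"
    unfolding clique_iff_nsets_subset
  proof
    fix e assume e: "e \<in> nsets (V - h ` M) 2"
    then have "e \<in> nsets V 2" "e \<inter> h ` M = {}"
      by (auto simp: nsets_def)
    \<comment> \<open>A missing \<open>e\<close> would contain the deleted vertex
      \<open>h e\<close>, contrary to the disjointness just shown.\<close>
    then show "e \<in> E"
      using h[of e] unfolding M_def by blast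
  qed
  then have "card (V - h ` M) \<le> clique_number V E"
    using assms by (intro clique_number_ge) auto
  moreover have "card V - card (h ` M) \<le> card (V - h ` M)"
    using finM by (intro diff_card_le_card_Diff) auto
  moreover have "card (h ` M) \<le> card M"
    using finM by (rule card_image_le)
  ultimately show ?thesis
    unfolding M_def by linarith
qed

section \<open>Edge probabilities\<close>

lemma real_choose_two: "real (n choose 2) = real n * (real n - 1) / 2"
  by (cases n) (simp_all add: choose_two real_of_nat_div algebra_simps)

lemma prob_erdos_renyi:
  "measure_pmf.prob (erdos_renyi n p) A =
     measure_pmf.prob (Pi_pmf (nsets {1..n} 2) False (\<lambda>_. bernoulli_pmf p))
       {present. {e \<in> nsets {1..n} 2. present e} \<in> A}"
  by (simp add: erdos_renyi_def vimage_def)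

text \<open>In terms of edge indicators this is a product event: the coordinates in \<open>S\<close>
  are forced to be \<open>True\<close> and the others are free. Independence then gives one factor
  \<open>p\<close> for each element of \<open>S\<close>.\<close>

lemma prob_erdos_renyi_superset:
  assumes "0 \<le> p" "p \<le> 1" "S \<subseteq> nsets {1..n} 2"
  shows "measure_pmf.prob (erdos_renyi n p) {E. S \<subseteq> E} = p ^ card S"
proof -
  let ?N = "nsets {1..n} 2"
  have fin: "finite ?N"
    by (simp add: finite_imp_finite_nsets)
  have "{present. {e \<in> ?N. present e} \<in> {E. S \<subseteq> E}} =
        Pi ?N (\<lambda>e. if e \<in> S then {True} else UNIV)"
    using assms(3) by (auto simp: Pi_def split: if_splits)
  then have "measure_pmf.prob (erdos_renyi n p) {E. S \<subseteq> E} =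
      (\<Prod>e\<in>?N. measure_pmf.prob (bernoulli_pmf p) (if e \<in> S then {True} else UNIV))"
    by (simp add: prob_erdos_renyi measure_Pi_pmf_Pi[OF fin] del: One_nat_def)
  also have "\<dots> = (\<Prod>e\<in>?N. if e \<in> S then p else 1)"
    using assms by (intro prod.cong refl) (simp add: measure_pmf_single)
  also have "\<dots> = (\<Prod>e\<in>S. p)"
    using fin assms(3) by (simp add: prod.If_cases Int_absorb1)
  finally show ?thesis
    by simp
qed

lemma prob_edge_present:
  assumes "0 \<le> p" "p \<le> 1" "e \<in> nsets {1..n} 2"
  shows "measure_pmf.prob (erdos_renyi n p) {E. e \<in> E} = p"
  using prob_erdos_renyi_superset[of p "{e}" n] assms by simp

lemma prob_edge_missing:
  assumes "0 \<le> p" "p \<le> 1" "e \<in> nsets {1..n} 2"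
  shows "measure_pmf.prob (erdos_renyi n p) {E. e \<notin> E} = 1 - p"
proof -
  have "{E. e \<notin> E} = UNIV - {E. e \<in> E}"
    by auto
  then show ?thesis
    using measure_pmf.prob_compl[of "{E. e \<in> E}" "erdos_renyi n p"] prob_edge_present[OF assms]
    by simp
qed

text \<open>Union bound over all potential edges. Keeping \<open>Q\<close> abstract covers present
  edges with \<open>q = p\<close> and missing edges with \<open>q = 1 - p\<close>.\<close>

lemma prob_some_edge_le:
  assumes "\<And>e. e \<in> nsets {1..n} 2 \<Longrightarrow> measure_pmf.prob (erdos_renyi n p) {E. Q e E} = q"
    and "0 \<le> q"
  shows "measure_pmf.prob (erdos_renyi n p) {E. \<exists>e\<in>nsets {1..n} 2. Q e E} \<le> real n ^ 2 * q"
proof -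
  let ?N = "nsets {1..n} 2"
  have "{E. \<exists>e\<in>?N. Q e E} = (\<Union>e\<in>?N. {E. Q e E})"
    by auto
  then have "measure_pmf.prob (erdos_renyi n p) {E. \<exists>e\<in>?N. Q e E} \<le>
      (\<Sum>e\<in>?N. measure_pmf.prob (erdos_renyi n p) {E. Q e E})"
    by (auto intro!: measure_UNION_le finite_imp_finite_nsets)
  also have "\<dots> = real (n choose 2) * q"
    using assms by simp
  also have "\<dots> \<le> real n ^ 2 * q"
  proof (rule mult_right_mono)
    show "real (n choose 2) \<le> real n ^ 2"
      by (simp add: real_choose_two power2_eq_square field_simps)
  qed (use assms in simp)
  finally show ?thesis .
qed

text \<open>The number of missing edges is a sum of independent indicators, so its exponential is a
  product over edges and the expectation factorises. Each factor is 1 with probability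
  \<open>p\<close> and e with probability \<open>1 - p\<close>.\<close>

lemma expectation_exp_missing_edges:
  assumes "0 \<le> p" "p \<le> 1"
  shows "measure_pmf.expectation (erdos_renyi n p)
           (\<lambda>E. exp (real (card (nsets {1..n} 2 - E)))) = (p + (1 - p) * exp 1) ^ (n choose 2)"
proof -
  let ?N = "nsets {1..n} 2"
  let ?X = "Pi_pmf ?N False (\<lambda>_. bernoulli_pmf p)"
  have fin: "finite ?N"
    by (simp add: finite_imp_finite_nsets)
  have exp_card: "exp (real (card (?N - {e \<in> ?N. present e}))) =
      (\<Prod>e\<in>?N. if present e then 1 else exp 1)" for present
  proof -
    have "?N - {e \<in> ?N. present e} = ?N \<inter> - {e. present e}"
      by auto
    then show ?thesis
      using fin by (simp add: prod.If_cases flip: exp_of_nat_mult)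
  qed
  have "measure_pmf.expectation (erdos_renyi n p) (\<lambda>E. exp (real (card (?N - E)))) =
      measure_pmf.expectation ?X (\<lambda>present. \<Prod>e\<in>?N. if present e then 1 else exp 1)"
    by (simp add: erdos_renyi_def exp_card del: One_nat_def)
  also have "\<dots> = (\<Prod>e\<in>?N. measure_pmf.expectation (bernoulli_pmf p)
                        (\<lambda>b. if b then 1 else exp 1))"
    by (intro expectation_prod_Pi_pmf fin integrable_measure_pmf_finite) auto
  also have "\<dots> = (p + (1 - p) * exp 1) ^ (n choose 2)"
    using assms by (simp add: mult.commute)
  finally show ?thesis .
qed

lemma prob_missing_edges_ge:
  assumes "0 \<le> p" "p \<le> 1"
  shows "measure_pmf.prob (erdos_renyi n p) {E. t \<le> real (card (nsets {1..n} 2 - E))}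
           \<le> exp (real n ^ 2 * (1 - p) - t)"
proof -
  let ?M = "\<lambda>E. real (card (nsets {1..n} 2 - E))"
  \<comment> \<open>Finite support supplies the integrability required by the Markov
    inequality.\<close>
  have fin: "finite (set_pmf (erdos_renyi n p))"
  proof (rule finite_subset)
    show "set_pmf (erdos_renyi n p) \<subseteq> Pow (nsets {1..n} 2)"
      by (auto simp: erdos_renyi_def)
  qed (simp add: finite_imp_finite_nsets)
  have "measure_pmf.prob (erdos_renyi n p) {E. t \<le> ?M E} \<le>
      measure_pmf.expectation (erdos_renyi n p) (\<lambda>E. exp (?M E)) / exp t"
    using integral_Markov_inequality_measure[of "measure_pmf (erdos_renyi n p)"
        "\<lambda>E. exp (?M E)" UNIV "exp t"] fin
    by (simp add: integrable_measure_pmf_finite)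
  also have "\<dots> = (1 + (1 - p) * (exp 1 - 1)) ^ (n choose 2) / exp t"
    using assms by (simp add: expectation_exp_missing_edges algebra_simps del: One_nat_def)
  \<comment> \<open>By \<open>1 + x \<le> exp x\<close> the power becomes a single exponential,
    which can be combined with \<open>exp t\<close>.\<close>
  also have "(1 + (1 - p) * (exp 1 - 1)) ^ (n choose 2) \<le>
      exp ((1 - p) * (exp 1 - 1)) ^ (n choose 2)"
    using assms by (intro power_mono exp_ge_add_one_self) auto
  also have "\<dots> = exp (real (n choose 2) * ((1 - p) * (exp 1 - 1)))"
    by (simp add: exp_of_nat_mult)
  also have "real (n choose 2) * ((1 - p) * (exp 1 - 1)) \<le> real n ^ 2 * (1 - p)"
  proof -
    have "real (n choose 2) \<le> real n ^ 2 / 2"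
      by (simp add: real_choose_two power2_eq_square algebra_simps)
    \<comment> \<open>Since e is at most 3, the factor \<open>exp 1 - 1\<close> is at most 2, which
      cancels the 1/2 from the binomial coefficient.\<close>
    then have "real (n choose 2) * ((1 - p) * (exp 1 - 1)) \<le> (real n ^ 2 / 2) * ((1 - p) * 2)"
      using assms exp_le by (intro mult_mono) auto
    also have "\<dots> = real n ^ 2 * (1 - p)"
      by simp
    finally show ?thesis .
  qed
  finally show ?thesis
    by (simp add: exp_diff divide_right_mono)
qed

section \<open>Bounds for a fixed number of vertices\<close>

text \<open>Common frame for the bounds below: name a bad event \<open>B\<close>, bound its
  probability, and check that \<open>P\<close> holds outside it.\<close>

lemma prob_clique_number_ge:
  assumes "measure_pmf.prob (erdos_renyi n p) B \<le> b"
    and "\<And>E. E \<notin> B \<Longrightarrow> P (clique_number {1..n} E)"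
  shows "1 - b \<le> prob_clique_number n p P"
proof -
  have "1 - b \<le> 1 - measure_pmf.prob (erdos_renyi n p) B"
    using assms(1) by simp
  also have "\<dots> = measure_pmf.prob (erdos_renyi n p) (UNIV - B)"
    using measure_pmf.prob_compl[of B "erdos_renyi n p"] by simp
  also have "\<dots> \<le> prob_clique_number n p P"
    unfolding prob_clique_number_def
    using assms(2) by (intro measure_pmf.finite_measure_mono) auto
  finally show ?thesis .
qed

lemma prob_clique_number_eq_1_ge:
  assumes "0 \<le> p" "p \<le> 1" "1 \<le> n"
  shows "1 - real n ^ 2 * p \<le> prob_clique_number n p (\<lambda>\<omega>. \<omega> = 1)"
proof (rule prob_clique_number_ge)
  show "measure_pmf.prob (erdos_renyi n p) {E. \<exists>e\<in>nsets {1..n} 2. e \<in> E} \<le> real n ^ 2 * p"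
    using assms by (intro prob_some_edge_le prob_edge_present)
  show "clique_number {1..n} E = 1" if "E \<notin> {E. \<exists>e\<in>nsets {1..n} 2. e \<in> E}" for E
    using that assms(3) by (intro clique_number_eq_1) auto
qed

lemma prob_clique_number_eq_n_ge:
  assumes "0 \<le> p" "p \<le> 1"
  shows "1 - real n ^ 2 * (1 - p) \<le> prob_clique_number n p (\<lambda>\<omega>. \<omega> = n)"
proof (rule prob_clique_number_ge)
  show "measure_pmf.prob (erdos_renyi n p) {E. \<exists>e\<in>nsets {1..n} 2. e \<notin> E} \<le> real n ^ 2 * (1 - p)"
    using assms by (intro prob_some_edge_le prob_edge_missing) auto
  show "clique_number {1..n} E = n" if "E \<notin> {E. \<exists>e\<in>nsets {1..n} 2. e \<notin> E}" for E
  proof (rule antisym)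
    have "nsets {1..n} 2 - E = {}"
      using that by auto
    then have "card (nsets {1..n} 2 - E) = 0"
      by (simp only: card.empty)
    then show "n \<le> clique_number {1..n} E"
      using card_le_clique_number_plus_missing[of "{1..n}" E] by simp
  qed (use clique_number_le_card[of "{1..n}" E] in simp)
qed

text \<open>Here \<open>t\<close> is the number of vertices allowed to be lost. The bound has
  content once \<open>t\<close> exceeds \<open>real n ^ 2 * (1 - p)\<close>, which dominates the
  mean number of missing edges.\<close>

lemma prob_clique_number_ge_diff:
  assumes "0 \<le> p" "p \<le> 1"
  shows "1 - exp (real n ^ 2 * (1 - p) - t) \<le> prob_clique_number n p (\<lambda>\<omega>. real n - t \<le> real \<omega>)"
proof (rule prob_clique_number_ge)
  show "measure_pmf.prob (erdos_renyi n p) {E. t \<le> real (card (nsets {1..n} 2 - E))}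
      \<le> exp (real n ^ 2 * (1 - p) - t)"
    using assms by (rule prob_missing_edges_ge)
  show "real n - t \<le> real (clique_number {1..n} E)"
    if "E \<notin> {E. t \<le> real (card (nsets {1..n} 2 - E))}" for E
    using that card_le_clique_number_plus_missing[of "{1..n}" E] by simp
qed

lemma prob_clique_number_less_ge:
  assumes "0 \<le> p" "p \<le> 1"
  shows "1 - real n ^ k * p ^ (k choose 2) \<le> prob_clique_number n p (\<lambda>\<omega>. \<omega> < k)"
proof (rule prob_clique_number_ge)
  let ?B = "\<Union>W\<in>nsets {1..n} k. {E. nsets W 2 \<subseteq> E}"
  have "measure_pmf.prob (erdos_renyi n p) ?B \<le>
      (\<Sum>W\<in>nsets {1..n} k. measure_pmf.prob (erdos_renyi n p) {E. nsets W 2 \<subseteq> E})"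
    by (intro measure_UNION_le finite_imp_finite_nsets) auto
  also have "\<dots> = (\<Sum>W\<in>nsets {1..n} k. p ^ (k choose 2))"
  proof (rule sum.cong)
    fix W assume "W \<in> nsets {1..n} k"
    then have "W \<subseteq> {1..n}" "card W = k"
      by (auto simp: nsets_def)
    then show "measure_pmf.prob (erdos_renyi n p) {E. nsets W 2 \<subseteq> E} = p ^ (k choose 2)"
      using prob_erdos_renyi_superset[OF assms nsets_mono] by simp
  qed simp
  also have "\<dots> = real (n choose k) * p ^ (k choose 2)"
    by simp
  also have "\<dots> \<le> real n ^ k * p ^ (k choose 2)"
  proof (rule mult_right_mono)
    have "n choose k \<le> n ^ k"
      by (cases "k \<le> n") (auto simp: binomial_le_pow binomial_eq_0)
    then show "real (n choose k) \<le> real n ^ k"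
      by (metis of_nat_le_iff of_nat_power)
  qed (use assms in simp)
  finally show "measure_pmf.prob (erdos_renyi n p) ?B \<le> real n ^ k * p ^ (k choose 2)" .
  show "clique_number {1..n} E < k" if "E \<notin> ?B" for E
  proof (rule ccontr)
    obtain W where W: "W \<subseteq> {1..n}" "clique W E" "card W = clique_number {1..n} E"
      using clique_number_attained[of "{1..n}" E] by auto
    assume "\<not> clique_number {1..n} E < k"
    \<comment> \<open>A subset of a clique is a clique, so a largest clique can be cut down to
      exactly \<open>k\<close> vertices. Hence the union over sets of size \<open>k\<close> catches
      every larger clique.\<close>
    then obtain W' where W': "W' \<subseteq> W" "card W' = k" "finite W'"
      using W(3) by (metis not_less obtain_subset_with_card_n)
    then have "W' \<in> nsets {1..n} k" "nsets W' 2 \<subseteq> E"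
      using W nsets_mono[of W' W 2] by (auto simp: nsets_def clique_iff_nsets_subset)
    with that show False
      by auto
  qed
qed

text \<open>\<open>U\<close> is chosen so that \<open>(U - 1) * ln (1 / p) / 2 = ln n + f\<close>.
  For an integer \<open>k > U\<close> this makes \<open>n * p powr ((k - 1) / 2)\<close> at most
  \<open>exp (- f)\<close>. Its \<open>k\<close>-th power is the union bound, which is thus at most
  \<open>exp (- f * k)\<close>, and so at most \<open>exp (- f * U)\<close> when \<open>f\<close> is
  nonnegative.\<close>

lemma prob_clique_number_le_ge:
  assumes p: "0 < p" "p < 1" and n: "1 \<le> n"
    and U: "U = (2 * ln (real n) + 2 * f) / ln (1 / p) + 1" and U1: "1 \<le> U"
  shows "1 - exp (- (f * U)) \<le> prob_clique_number n p (\<lambda>\<omega>. real \<omega> \<le> U)"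
proof (cases "f \<ge> 0")
  \<comment> \<open>A sequence tending to infinity may have negative early terms. There
    \<open>exp (- (f * U))\<close> is at least 1 and the claim is trivial.\<close>
  case False
  then have "1 - exp (- (f * U)) \<le> 0"
    using U1 by (simp add: mult_nonpos_nonneg)
  also have "\<dots> \<le> prob_clique_number n p (\<lambda>\<omega>. real \<omega> \<le> U)"
    by (simp add: prob_clique_number_def)
  finally show ?thesis .
next
  case True
  \<comment> \<open>The least integer strictly above \<open>U\<close>, so that
    \<open>w \<le> U\<close> and \<open>w < k\<close> agree for natural \<open>w\<close>;
    \<open>U \<ge> 1\<close> makes the conversion by \<open>nat\<close> harmless.\<close>
  define k where "k = nat \<lfloor>U\<rfloor> + 1"
  have k: "U < real k"
    unfolding k_def using U1 by linarith
  have le_U: "real w \<le> U \<longleftrightarrow> w < k" for w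
    unfolding k_def using U1 by linarith
  have lnp: "0 < ln (1 / p)"
    using p by simp
  have "ln (real n) + f = (U - 1) * ln (1 / p) / 2"
    using lnp by (simp add: U field_simps)
  also have "\<dots> \<le> (real k - 1) * ln (1 / p) / 2"
    using k lnp by (intro divide_right_mono mult_right_mono) auto
  finally have "real k * (ln (real n) + f) \<le> real k * ((real k - 1) * ln (1 / p) / 2)"
    by (rule mult_left_mono) simp
  also have "\<dots> = - (real (k choose 2) * ln p)"
    using p by (simp add: real_choose_two ln_div k_def field_simps)
  finally have le: "real k * ln (real n) + real (k choose 2) * ln p \<le> - (real k * f)"
    by (simp add: algebra_simps)
  have "real n ^ k * p ^ (k choose 2) = exp (real k * ln (real n) + real (k choose 2) * ln p)"
    using p n by (simp add: exp_add exp_of_nat_mult)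
  also have "\<dots> \<le> exp (- (f * U))"
    using le mult_right_mono[OF less_imp_le[OF k] True] by (simp add: mult.commute)
  finally show ?thesis
    using prob_clique_number_less_ge[of p n k] p by (simp add: le_U)
qed

section \<open>Asymptotics\<close>

text \<open>Any \<open>\<beta>\<close> strictly below a lower limit is eventually exceeded by the
  sequence itself. From \<open>n = 2\<close> on \<open>ln n\<close> is positive, so the quotient can
  be cleared and exponentiated.\<close>

lemma decay_exponent_eventually_le:
  assumes pos: "\<And>n. 0 < q n" and "ereal \<beta> < decay_exponent q"
  shows "\<forall>\<^sub>F n in sequentially. q n \<le> real n powr - \<beta>"
proof -
  have "\<forall>\<^sub>F n in sequentially. ereal \<beta> < ereal (ln (1 / q n) / ln (real n))"
    using assms(2) unfolding decay_exponent_def by (rule less_LiminfD)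
  then show ?thesis
    using eventually_ge_at_top[of 2]
  proof eventually_elim
    case (elim n)
    have "0 < ln (real n)"
      using elim by simp
    then have "\<beta> * ln (real n) < ln (1 / q n)"
      using elim by (simp add: pos_less_divide_eq)
    then have "ln (q n) \<le> - \<beta> * ln (real n)"
      using pos[of n] by (simp add: ln_div)
    then have "exp (ln (q n)) \<le> exp (- \<beta> * ln (real n))"
      by simp
    then show ?case
      using pos[of n] elim by (simp add: powr_def)
  qed
qed

lemma square_mult_le_powr:
  assumes "1 \<le> n" "q \<le> real n powr - \<beta>"
  shows "real n ^ 2 * q \<le> real n powr (2 - \<beta>)"
proof -
  have "real n ^ 2 * q \<le> real n powr 2 * real n powr - \<beta>"
    using assms by (simp add: mult_left_mono powr_numeral)
  also have "\<dots> = real n powr (2 - \<beta>)"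
    using powr_add[of "real n" 2 "- \<beta>"] by simp
  finally show ?thesis .
qed

text \<open>After division by \<open>real n powr c\<close> both terms have negative exponents and
  tend to 0, so their sum is eventually below 1.\<close>

lemma eventually_powr_add_le:
  fixes a b c :: real
  assumes "a < c" "b < c"
  shows "\<forall>\<^sub>F n in sequentially. real n powr a + real n powr b \<le> real n powr c"
proof -
  have "((\<lambda>n. real n powr (a - c) + real n powr (b - c)) \<longlongrightarrow> 0 + 0) sequentially"
    using assms by (intro tendsto_add tendsto_neg_powr filterlim_real_sequentially) auto
  then have "\<forall>\<^sub>F n in sequentially. real n powr (a - c) + real n powr (b - c) < 1"
    by (rule order_tendstoD) simp
  then show ?thesis
    using eventually_gt_at_top[of 0]
  proof eventually_elim
    case (elim n)
    then have "(real n powr (a - c) + real n powr (b - c)) * real n powr c \<le> 1 * real n powr c"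
      by (intro mult_right_mono) auto
    then show ?case
      by (simp add: distrib_right flip: powr_add)
  qed
qed

theorem proposition2:
  fixes p :: "nat \<Rightarrow> real"
  assumes p: "\<And>n. 0 < p n \<and> p n < 1"
  shows
    "(\<forall>\<alpha>1 \<epsilon> :: real.
        decay_exponent p = ereal \<alpha>1 \<and> \<alpha>1 > 2 \<and> \<epsilon> > 0 \<and> \<alpha>1 - \<epsilon> > 2 \<longrightarrow>
        (\<forall>\<^sub>F n in sequentially.
           prob_clique_number n (p n) (\<lambda>\<omega>. \<omega> = 1)
             \<ge> 1 - 1 / real n powr (\<alpha>1 - \<epsilon> - 2)))
   \<and> (\<forall>\<alpha>2 \<epsilon> :: real.
        decay_exponent (\<lambda>n. 1 - p n) = ereal \<alpha>2 \<and> \<alpha>2 > 2 \<and> \<epsilon> > 0 \<and> \<alpha>2 - \<epsilon> > 2 \<longrightarrow>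
        (\<forall>\<^sub>F n in sequentially.
           prob_clique_number n (p n) (\<lambda>\<omega>. \<omega> = n)
             \<ge> 1 - 1 / real n powr (\<alpha>2 - \<epsilon> - 2)))
   \<and> (\<forall>\<alpha>2 \<epsilon> :: real.
        decay_exponent (\<lambda>n. 1 - p n) = ereal \<alpha>2 \<and> 1 < \<alpha>2 \<and> \<alpha>2 < 2 \<and> \<epsilon> > 0 \<and>
        0 < 2 - \<alpha>2 - 2 * \<epsilon> \<and> 2 - \<alpha>2 - 2 * \<epsilon> < 2 - \<alpha>2 + 2 * \<epsilon> \<and> 2 - \<alpha>2 + 2 * \<epsilon> < 1 \<longrightarrow>
        (\<forall>\<^sub>F n in sequentially.
           prob_clique_number n (p n)
               (\<lambda>\<omega>. real \<omega> \<ge> real n - real n powr (2 - \<alpha>2 + 2 * \<epsilon>))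
             \<ge> 1 - exp (- (real n powr (2 - \<alpha>2 - 2 * \<epsilon>)))))
   \<and> (\<forall>f U :: nat \<Rightarrow> real.
        filterlim f at_top sequentially \<and>
        (\<forall>n. U n = (2 * ln (real n) + 2 * f n) / ln (1 / p n) + 1) \<longrightarrow>
        (\<forall>n\<ge>2. U n \<ge> 1 \<longrightarrow>
           prob_clique_number n (p n) (\<lambda>\<omega>. real \<omega> \<le> U n)
             \<ge> 1 - exp (- (f n * U n))))"
proof (intro conjI allI impI)
  fix \<alpha>1 \<epsilon> :: real
  assume A: "decay_exponent p = ereal \<alpha>1 \<and> \<alpha>1 > 2 \<and> \<epsilon> > 0 \<and> \<alpha>1 - \<epsilon> > 2"
  \<comment> \<open>The margin \<open>\<epsilon>\<close> provides the strict inequality below the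
    decay exponent.\<close>
  have "\<forall>\<^sub>F n in sequentially. p n \<le> real n powr - (\<alpha>1 - \<epsilon>)"
    using A p by (intro decay_exponent_eventually_le) auto
  then show "\<forall>\<^sub>F n in sequentially. prob_clique_number n (p n) (\<lambda>\<omega>. \<omega> = 1)
      \<ge> 1 - 1 / real n powr (\<alpha>1 - \<epsilon> - 2)"
    using eventually_ge_at_top[of 1]
  proof eventually_elim
    case (elim n)
    have "real n ^ 2 * p n \<le> real n powr (2 - (\<alpha>1 - \<epsilon>))"
      using elim by (intro square_mult_le_powr)
    also have "\<dots> = 1 / real n powr (\<alpha>1 - \<epsilon> - 2)"
      by (simp flip: powr_minus_divide)
    finally show ?case
      using prob_clique_number_eq_1_ge[of "p n" n] p[of n] elim by simp
  qed
next
  fix \<alpha>2 \<epsilon> :: real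
  assume A: "decay_exponent (\<lambda>n. 1 - p n) = ereal \<alpha>2 \<and> \<alpha>2 > 2 \<and> \<epsilon> > 0 \<and> \<alpha>2 - \<epsilon> > 2"
  have "\<forall>\<^sub>F n in sequentially. 1 - p n \<le> real n powr - (\<alpha>2 - \<epsilon>)"
    using A p by (intro decay_exponent_eventually_le) auto
  then show "\<forall>\<^sub>F n in sequentially. prob_clique_number n (p n) (\<lambda>\<omega>. \<omega> = n)
      \<ge> 1 - 1 / real n powr (\<alpha>2 - \<epsilon> - 2)"
    using eventually_ge_at_top[of 1]
  proof eventually_elim
    case (elim n)
    have "real n ^ 2 * (1 - p n) \<le> real n powr (2 - (\<alpha>2 - \<epsilon>))"
      using elim by (intro square_mult_le_powr)
    also have "\<dots> = 1 / real n powr (\<alpha>2 - \<epsilon> - 2)"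
      by (simp flip: powr_minus_divide)
    finally show ?case
      using prob_clique_number_eq_n_ge[of "p n" n] p[of n] by simp
  qed
next
  fix \<alpha>2 \<epsilon> :: real
  assume A: "decay_exponent (\<lambda>n. 1 - p n) = ereal \<alpha>2 \<and> 1 < \<alpha>2 \<and> \<alpha>2 < 2 \<and> \<epsilon> > 0 \<and>
    0 < 2 - \<alpha>2 - 2 * \<epsilon> \<and> 2 - \<alpha>2 - 2 * \<epsilon> < 2 - \<alpha>2 + 2 * \<epsilon> \<and> 2 - \<alpha>2 + 2 * \<epsilon> < 1"
  have "\<forall>\<^sub>F n in sequentially. 1 - p n \<le> real n powr - (\<alpha>2 - \<epsilon>)"
    using A p by (intro decay_exponent_eventually_le) auto
  \<comment> \<open>The first summand will bound \<open>n ^ 2 * (1 - p n)\<close> and the second is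
    the wanted tail exponent. Both powers lie below \<open>2 - \<alpha>2 + 2 * \<epsilon>\<close>,
    so the allowed loss eventually pays for both together.\<close>
  moreover have "\<forall>\<^sub>F n in sequentially. real n powr (2 - (\<alpha>2 - \<epsilon>)) + real n powr (2 - \<alpha>2 - 2 * \<epsilon>)
      \<le> real n powr (2 - \<alpha>2 + 2 * \<epsilon>)"
    using A by (intro eventually_powr_add_le) auto
  ultimately show "\<forall>\<^sub>F n in sequentially.
      prob_clique_number n (p n) (\<lambda>\<omega>. real \<omega> \<ge> real n - real n powr (2 - \<alpha>2 + 2 * \<epsilon>))
        \<ge> 1 - exp (- (real n powr (2 - \<alpha>2 - 2 * \<epsilon>)))"
    using eventually_ge_at_top[of 1]
  proof eventually_elim
    case (elim n)
    let ?t = "real n powr (2 - \<alpha>2 + 2 * \<epsilon>)"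
    have "real n ^ 2 * (1 - p n) \<le> real n powr (2 - (\<alpha>2 - \<epsilon>))"
      using elim by (intro square_mult_le_powr)
    then have "1 - exp (- (real n powr (2 - \<alpha>2 - 2 * \<epsilon>))) \<le> 1 - exp (real n ^ 2 * (1 - p n) - ?t)"
      using elim by simp
    also have "\<dots> \<le> prob_clique_number n (p n) (\<lambda>\<omega>. real \<omega> \<ge> real n - ?t)"
      using p[of n] by (intro prob_clique_number_ge_diff) auto
    finally show ?case .
  qed
next
  fix f U :: "nat \<Rightarrow> real" and n :: nat
  assume "filterlim f at_top sequentially \<and>
      (\<forall>n. U n = (2 * ln (real n) + 2 * f n) / ln (1 / p n) + 1)"
    and "2 \<le> n" "1 \<le> U n"
  \<comment> \<open>This part is the bound for a fixed number of vertices, applied separately at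
    each \<open>n\<close>.\<close>
  then show "prob_clique_number n (p n) (\<lambda>\<omega>. real \<omega> \<le> U n) \<ge> 1 - exp (- (f n * U n))"
    using p[of n] by (intro prob_clique_number_le_ge) auto
qed

end
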